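(* Let $q\ge 2$ be an integer, $\lambda\in\mathbb{C}\setminus\{0\}$, $k\in\mathbb{N}_0$, let $p$ be a positive integer, and denote by $U_p$ the set of $p$th roots of unity. Suppose that for each $\zeta\in U_p$ we have a continuous $1$-periodic function $$\Phi_{(\zeta\lambda)k}(u)=\sum_{\ell\in\mathbb{Z}}\varphi_{(\zeta\lambda)k\ell}\exp(2\ell\pi i u)$$ whose Fourier coefficients are $$\varphi_{(\zeta\lambda)k\ell}=\operatorname{Res}\Bigl(\mathcal{D}(s)\Bigl(s-\log_q(\zeta\lambda)-\frac{2\ell\pi i}{\log q}\Bigr)^k,\ s=\log_q(\zeta\lambda)+\frac{2\ell\pi i}{\log q}\Bigr)$$ for a suitable function $\mathcal{D}(s)$ (the same for all $\zeta\in U_p$ and $\ell\in\mathbb{Z}$, and such that these residues are defined). Then, for all positive integers $N$, $$\sum_{\zeta\in U_p}N^{\log_q(\zeta\lambda)}(\log_q N)^k\,\Phi_{(\zeta\lambda)k}(\{\log_q N\})=N^{\log_q\lambda}(\log_q N)^k\,\Phi\bigl(p\{\log_{q^p}N\}\bigr)$$ with a continuous $p$-periodic function $$\Phi(u)=\sum_{\ell\in\mathbb{Z}}\varphi_\ell\exp\Bigl(\frac{2\ell\pi i}{p}u\Bigr)$$ whose Fourier coefficients are $$\varphi_\ell=\operatorname{Res}\Bigl(\mathcal{D}(s)\Bigl(s-\log_q\lambda-\frac{2\ell\pi i}{p\log q}\Bigr)^k,\ s=\log_q\lambda+\frac{2\ell\pi i}{p\log q}\Bigr).$$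
   Context: $\log$ is the principal value of the complex logarithm (imaginary part in $(-\pi,\pi]$) and $\log_q z=\log z/\log q$. $\{z\}=z-\lfloor z\rfloor$ is the fractional part of a real number $z$. $\operatorname{Res}(f(s),s=s_0)$ is the residue at $s_0$ of a function $f$ that is meromorphic near $s_0$. A function is $p$-periodic if it is periodic with period $p$. *)

theory Defs
  imports "HOL-Complex_Analysis.Complex_Analysis"
begin

(* Complex logarithm to base q, with the principal value of Ln (imaginary part in (-pi, pi]). *)
definition clog :: "nat \<Rightarrow> complex \<Rightarrow> complex" where
  "clog q z = Ln z / of_real (ln (real q))"

definition fourier_coeff :: "real \<Rightarrow> (real \<Rightarrow> complex) \<Rightarrow> int \<Rightarrow> complex" where
  "fourier_coeff T f l =
     integral {0..T} (\<lambda>u. f u * exp (- (2 * of_int l * of_real pi * \<i> / of_real T * of_real u)))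
       / of_real T"

(* f(u) is the sum of c(l) exp(2 l pi i u / T) over all integers l: the c(l) are the Fourier
   coefficients of f with respect to the period T, and the series converges to f pointwise,
   bilateral series being summed symmetrically, as usual for Fourier series
   (no absolute convergence is implied). *)
definition has_fourier_series :: "real \<Rightarrow> (real \<Rightarrow> complex) \<Rightarrow> (int \<Rightarrow> complex) \<Rightarrow> bool" where
  "has_fourier_series T f c \<longleftrightarrow>
     (\<forall>l. fourier_coeff T f l = c l) \<and>
     (\<forall>u. (\<lambda>M. \<Sum>l\<in>{- int M..int M}.
              c l * exp (2 * of_int l * of_real pi * \<i> / of_real T * of_real u))
            \<longlonglongrightarrow> f u)"

(* The constant residue is total, so being meromorphic near s0 is what makes Res(f, s0) defined. *)
definition has_residue :: "(complex \<Rightarrow> complex) \<Rightarrow> complex \<Rightarrow> complex \<Rightarrow> bool" where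
  "has_residue f s0 r \<longleftrightarrow> f meromorphic_on {s0} \<and> residue f s0 = r"

end

theory Submission
  imports Defs
begin

text \<open>
  The principal logarithms of \<open>\<zeta> * lam\<close> and \<open>lam\<close> differ by a logarithm of the root of unity \<open>\<zeta>\<close>,
  so there is an integer \<open>c(\<zeta>)\<close> with
  \<open>log\<^sub>q (\<zeta> * lam) = log\<^sub>q lam + 2 c(\<zeta>) \<pi> i / (p log q)\<close> and \<open>\<zeta> = exp (2 \<pi> i c(\<zeta>) / p)\<close>
  (lemma \<open>clog_root_of_unity_mult\<close>).  The second equation says that \<open>c\<close> picks exactly one
  representative of every residue class modulo \<open>p\<close>; which representative it is depends on where
  the branch cut lies.

  Put \<open>L = log\<^sub>q N\<close>.  The first equation gives
  \<open>N powr log\<^sub>q (\<zeta> * lam) = N powr log\<^sub>q lam * exp (2 \<pi> i c(\<zeta>) L / p)\<close>, which suggests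
  \<open>\<Phi>(u) = (\<Sum>\<zeta>. exp (2 \<pi> i c(\<zeta>) u / p) * \<Phi>\<^sub>\<zeta>(u))\<close>.  This function is continuous and
  \<open>p\<close>-periodic, and as \<open>p * frac (L / p)\<close> differs from \<open>L\<close> by a multiple of \<open>p\<close>, the asserted
  identity holds.

  Multiplication by \<open>exp (2 \<pi> i c u / p)\<close> moves the \<open>m\<close>-th Fourier coefficient of the
  \<open>1\<close>-periodic function \<open>\<Phi>\<^sub>\<zeta>\<close> to the index \<open>c + p m\<close> of the \<open>p\<close>-periodic product
  (lemma \<open>has_fourier_series_modulate\<close>).  The \<open>p\<close> summands therefore occupy disjoint residue
  classes of indices, and the coefficient of \<open>\<Phi>\<close> at \<open>l = c(\<zeta>) + p m\<close> is the residue at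
  \<open>log\<^sub>q (\<zeta> * lam) + 2 m \<pi> i / log q = log\<^sub>q lam + 2 l \<pi> i / (p log q)\<close>, as required.

  The one analytic subtlety is convergence.  The series of \<open>\<Phi>\<^sub>\<zeta>\<close> are only assumed to converge
  along symmetric partial sums, whereas a symmetric window for \<open>l = c + p m\<close> is an asymmetric
  one for \<open>m\<close>.  The two windows differ by a bounded number of indices far out, and the
  coefficients there tend to zero by the Riemann--Lebesgue lemma, which for continuous periodic
  functions follows from a shift by half a wavelength.
\<close>

section \<open>Unimodular characters\<close>

definition wave :: "real \<Rightarrow> complex" where
  "wave x = cis (2 * pi * x)"

lemma wave_add: "wave (x + y) = wave x * wave y"
  by (simp add: wave_def cis_mult ring_distribs)

lemma norm_wave [simp]: "norm (wave x) = 1"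
  by (simp add: wave_def)

lemma wave_of_int [simp]: "wave (of_int n) = 1"
  using cis_multiple_2pi[of "of_int n"] by (simp add: wave_def mult_ac)

lemma wave_half [simp]: "wave (1 / 2) = - 1" "wave (- (1 / 2)) = - 1"
  by (simp_all add: wave_def complex_eq_iff)

lemma wave_power: "wave x ^ n = wave (real n * x)"
  by (simp only: wave_def Complex.DeMoivre) (simp only: mult_ac)

lemma wave_eq_1_iff: "wave x = 1 \<longleftrightarrow> x \<in> \<int>"
proof
  assume "wave x = 1"
  then have "exp (\<i> * of_real (2 * pi * x)) = 1"
    by (simp add: wave_def cis_conv_exp)
  then obtain n :: int where "2 * pi * x = of_int (2 * n) * pi"
    by (auto simp: exp_eq_1)
  then have "x = of_int n" by simp
  then show "x \<in> \<int>" by simp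
qed (auto elim: Ints_cases)

lemma wave_eq_iff: "wave x = wave y \<longleftrightarrow> x - y \<in> \<int>"
proof -
  have "wave x = wave (x - y) * wave y"
    by (simp flip: wave_add)
  moreover have "wave y \<noteq> 0"
    using norm_wave[of y] by (metis norm_zero zero_neq_one)
  ultimately show ?thesis
    by (simp flip: wave_eq_1_iff)
qed

lemma continuous_on_wave [continuous_intros]:
  "continuous_on A f \<Longrightarrow> continuous_on A (\<lambda>x. wave (f x))"
  unfolding wave_def by (intro continuous_intros)

lemma of_int_divide_in_Ints_iff:
  assumes "p > 0"
  shows "(of_int d / real p :: real) \<in> \<int> \<longleftrightarrow> int p dvd d"
proof
  assume "(of_int d / real p :: real) \<in> \<int>"
  then obtain n where "(of_int d / real p :: real) = of_int n"
    by (auto elim: Ints_cases)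
  then have "(of_int d :: real) = of_int (int p * n)"
    using assms by (simp add: field_simps)
  then show "int p dvd d"
    by (metis dvd_triv_left of_int_eq_iff)
qed (use assms in auto)

lemma sum_wave_multiples:
  assumes "p > 0"
  shows "(\<Sum>r<p. wave (of_int d * real r / real p)) = (if int p dvd d then of_nat p else 0)"
proof -
  define w where "w = wave (of_int d / real p)"
  have "(\<Sum>r<p. wave (of_int d * real r / real p)) = (\<Sum>r<p. w ^ r)"
    by (simp add: w_def wave_power mult_ac)
  moreover have "w = 1 \<longleftrightarrow> int p dvd d"
    unfolding w_def wave_eq_1_iff by (rule of_int_divide_in_Ints_iff[OF assms])
  moreover have "w ^ p = 1"
    using assms by (simp add: w_def wave_power)
  ultimately show ?thesis
    by (cases "w = 1") (simp_all add: geometric_sum)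
qed

lemma exp_eq_wave:
  "exp (2 * of_int l * of_real pi * \<i> / of_real T * of_real u) = wave (of_int l * u / T)"
  "exp (- (2 * of_int l * of_real pi * \<i> / of_real T * of_real u)) = wave (- (of_int l * u / T))"
  by (simp_all add: wave_def cis_conv_exp mult_ac)

lemma has_fourier_series_wave:
  "has_fourier_series T f c \<longleftrightarrow>
     (\<forall>l. fourier_coeff T f l = c l) \<and>
     (\<forall>u. (\<lambda>M. \<Sum>l\<in>{- int M..int M}. c l * wave (of_int l * u / T)) \<longlonglongrightarrow> f u)"
  by (simp only: has_fourier_series_def exp_eq_wave)

lemma fourier_coeff_wave:
  "fourier_coeff T f l = integral {0..T} (\<lambda>u. f u * wave (- (of_int l * u / T))) / of_real T"
  by (simp only: fourier_coeff_def exp_eq_wave)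


section \<open>Fourier coefficients of continuous periodic functions tend to zero\<close>

lemma integral_periodic_shift:
  fixes f :: "real \<Rightarrow> complex"
  assumes cont: "continuous_on UNIV f" and per: "\<And>x. f (x + 1) = f x"
    and a: "0 \<le> a" "a \<le> 1"
  shows "integral {0..1} (\<lambda>x. f (x + a)) = integral {0..1} f"
proof -
  have int: "f integrable_on {x..y}" for x y
    by (intro integrable_continuous_real continuous_on_subset[OF cont]) auto
  have "integral {0..1} (\<lambda>x. f (x + a)) = integral {a..1 + a} f"
    using integral_shift_real_ivl[of a a "1 + a" f] by simp
  also have "\<dots> = integral {a..1} f + integral {1..1 + a} f"
    using a int by (intro Henstock_Kurzweil_Integration.integral_combine[symmetric]) auto
  also have "integral {1..1 + a} f = integral {0..a} f"
    using integral_shift_real_ivl[of 1 1 "1 + a" f] by (simp add: per)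
  also have "integral {a..1} f + integral {0..a} f = integral {0..1} f"
    using a int
    by (subst add.commute) (intro Henstock_Kurzweil_Integration.integral_combine; simp)
  finally show ?thesis .
qed

text \<open>
  Shifting the variable by half a wavelength \<open>h\<close> flips the sign of the exponential, so twice the
  coefficient is the integral of \<open>(f u - f (u + h))\<close> times a unimodular factor, which is small by
  uniform continuity.
\<close>

lemma riemann_lebesgue_continuous_periodic:
  fixes f :: "real \<Rightarrow> complex"
  assumes cont: "continuous_on UNIV f" and per: "\<And>x. f (x + 1) = f x" and "e > 0"
  obtains K :: int where "\<And>l. \<bar>l\<bar> \<ge> K \<Longrightarrow> norm (fourier_coeff 1 f l) < e"
proof -
  have "uniformly_continuous_on {0..2} f"
    by (intro compact_uniformly_continuous continuous_on_subset[OF cont]) auto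
  then obtain \<delta> where \<delta>: "\<delta> > 0"
    "\<And>x y. x \<in> {0..2} \<Longrightarrow> y \<in> {0..2} \<Longrightarrow> dist y x < \<delta> \<Longrightarrow> dist (f y) (f x) < e"
    using \<open>e > 0\<close> unfolding uniformly_continuous_on_def by metis
  define K where "K = \<lceil>1 / \<delta>\<rceil> + 1"
  have "norm (fourier_coeff 1 f l) < e" if l: "\<bar>l\<bar> \<ge> K" for l
  proof -
    have "1 / \<delta> < of_int \<bar>l\<bar>"
      using l unfolding K_def by linarith
    moreover have "1 / \<delta> > 0"
      using \<delta> by simp
    ultimately have l0: "l \<noteq> 0"
      by auto
    then have l1: "(1 :: real) \<le> of_int \<bar>l\<bar>"
      by linarith
    have l\<delta>: "1 / of_int \<bar>l\<bar> < \<delta>"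
      using \<open>1 / \<delta> < of_int \<bar>l\<bar>\<close> l1 \<delta>(1) by (simp add: divide_less_eq mult.commute)
    define h :: real where "h = 1 / (2 * of_int \<bar>l\<bar>)"
    have h: "0 \<le> h" "h \<le> 1" "h < \<delta>"
      using l0 l1 l\<delta> \<delta> by (auto simp: h_def field_simps)
    have lh: "of_int l * h = 1 / 2 \<or> of_int l * h = - (1 / 2)"
      using l0 by (auto simp: h_def abs_if)
    define F where "F u = f u * wave (- (of_int l * u))" for u
    have contF: "continuous_on UNIV F"
      unfolding F_def by (intro continuous_intros cont)
    have perF: "F (x + 1) = F x" for x
    proof -
      have "wave (- (of_int l * (x + 1))) = wave (- (of_int l * x)) * wave (of_int (- l))"
        by (simp add: algebra_simps flip: wave_add)
      then show ?thesis
        by (simp only: F_def per wave_of_int mult_1_right)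
    qed
    have shift: "F (u + h) = - (f (u + h) * wave (- (of_int l * u)))" for u
    proof -
      have "wave (- (of_int l * (u + h))) = wave (- (of_int l * u)) * wave (- (of_int l * h))"
        by (simp add: algebra_simps flip: wave_add)
      moreover have "wave (- (of_int l * h)) = - 1"
        using lh by (elim disjE) (simp_all only: wave_half minus_minus)
      ultimately show ?thesis
        by (simp add: F_def)
    qed
    have int: "F integrable_on {0..1}" "(\<lambda>u. F (u + h)) integrable_on {0..1}"
      by (intro integrable_continuous_real continuous_intros
            continuous_on_compose2[OF contF]; auto intro!: continuous_intros)+
    have "2 * integral {0..1} F = integral {0..1} F + integral {0..1} (\<lambda>u. F (u + h))"
      using integral_periodic_shift[OF contF perF h(1,2)] by simp
    also have "\<dots> = integral {0..1} (\<lambda>u. F u + F (u + h))"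
      using int by (simp add: integral_add)
    finally have "norm (2 * integral {0..1} F) = norm (integral {0..1} (\<lambda>u. F u + F (u + h)))"
      by simp
    also have "\<dots> \<le> e * (1 - 0)"
    proof (rule integral_bound)
      show "continuous_on {0..1} (\<lambda>u. F u + F (u + h))"
        by (intro continuous_intros continuous_on_compose2[OF contF]) auto
      show "norm (F u + F (u + h)) \<le> e" if "u \<in> {0..1}" for u
      proof -
        have "F u + F (u + h) = (f u - f (u + h)) * wave (- (of_int l * u))"
          unfolding shift by (simp add: F_def algebra_simps)
        then have "norm (F u + F (u + h)) = dist (f u) (f (u + h))"
          by (simp add: norm_mult dist_norm)
        also have "\<dots> < e"
          using that h by (intro \<delta>) (auto simp: dist_norm)
        finally show ?thesis by simp
      qed
    qed auto
    finally have "norm (integral {0..1} F) \<le> e / 2"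
      by (simp add: norm_mult)
    moreover have "fourier_coeff 1 f l = integral {0..1} F"
      by (simp add: fourier_coeff_wave F_def[abs_def])
    ultimately show ?thesis
      using \<open>e > 0\<close> by simp
  qed
  then show thesis
    by (rule that)
qed


section \<open>Bilateral series summed over shifted windows\<close>

text \<open>
  With \<open>K = M div p\<close>, the window \<open>\<bar>c + p m\<bar> \<le> M\<close> and the symmetric window \<open>\<bar>m\<bar> \<le> K\<close> differ only
  in indices \<open>m\<close> with \<open>\<bar>m\<bar>\<close> within \<open>\<bar>c\<bar>\<close> of \<open>K\<close>.  Their number is bounded independently of \<open>M\<close>, so
  the difference of the two sums vanishes in the limit once the terms tend to zero.
\<close>

lemma tendsto_sum_shifted_window:
  fixes b :: "int \<Rightarrow> 'a :: real_normed_vector"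
  assumes lim: "(\<lambda>M. \<Sum>m\<in>{- int M..int M}. b m) \<longlonglongrightarrow> S"
    and small: "\<And>e. e > 0 \<Longrightarrow> \<exists>K. \<forall>m. \<bar>m\<bar> \<ge> K \<longrightarrow> norm (b m) < e"
    and p: "p > 0"
  shows "(\<lambda>M. \<Sum>m | \<bar>c + int p * m\<bar> \<le> int M. b m) \<longlonglongrightarrow> S"
proof -
  define A where "A M = {m. \<bar>c + int p * m\<bar> \<le> int M}" for M
  define B where "B M = {- int M..int M}" for M
  define J where "J = {- \<bar>c\<bar>..\<bar>c\<bar>}"
  define R where "R M = (\<Sum>j\<in>J. norm (b (int (M div p) + j)) + norm (b (- (int (M div p) + j))))"
    for M
  have div_top: "filterlim (\<lambda>M. M div p) at_top sequentially"
  proof (rule filterlim_at_top[THEN iffD2], rule allI)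
    fix Z
    show "\<forall>\<^sub>F M in sequentially. Z \<le> M div p"
      using eventually_ge_at_top[of "Z * p"]
      by eventually_elim (use p in \<open>simp add: less_eq_div_iff_mult_less_eq\<close>)
  qed
  have sym: "(\<lambda>M. \<Sum>m\<in>B (M div p). b m) \<longlonglongrightarrow> S"
    using filterlim_compose[OF lim div_top] by (simp add: B_def)
  have far: "(\<lambda>M. norm (b (g M))) \<longlonglongrightarrow> 0"
    if g: "\<And>M. \<bar>g M\<bar> \<ge> int (M div p) - \<bar>j\<bar>" for g j
  proof (rule tendsto_norm_zero, rule tendstoI)
    fix e :: real
    assume "e > 0"
    then obtain K where K: "\<And>m. \<bar>m\<bar> \<ge> K \<Longrightarrow> norm (b m) < e"
      using small by blast
    have "\<forall>\<^sub>F M in sequentially. nat (K + \<bar>j\<bar>) \<le> M div p"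
      using div_top by (simp add: filterlim_at_top)
    then show "\<forall>\<^sub>F M in sequentially. dist (b (g M)) 0 < e"
    proof eventually_elim
      case (elim M)
      then have "\<bar>g M\<bar> \<ge> K"
        using g[of M] by linarith
      then show ?case
        by (simp add: K)
    qed
  qed
  have "R \<longlonglongrightarrow> (\<Sum>j\<in>J. 0 + 0)"
    unfolding R_def
  proof (intro tendsto_sum tendsto_add)
    show "(\<lambda>M. norm (b (int (M div p) + j))) \<longlonglongrightarrow> 0" for j
      by (rule far[of j]) linarith
    show "(\<lambda>M. norm (b (- (int (M div p) + j)))) \<longlonglongrightarrow> 0" for j
      by (rule far[of j]) linarith
  qed
  then have R: "R \<longlonglongrightarrow> 0"
    by simp
  have bound: "norm ((\<Sum>m\<in>A M. b m) - (\<Sum>m\<in>B (M div p). b m)) \<le> R M" for M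
  proof -
    define K where "K = int (M div p)"
    define C where "C = (\<lambda>j. K + j) ` J \<union> (\<lambda>j. - (K + j)) ` J"
    have K: "int p * K \<le> int M" "int M < int p * (K + 1)"
    proof -
      have M: "int M = int p * K + int (M mod p)"
        unfolding K_def by (metis mult_div_mod_eq of_nat_add of_nat_mult)
      have "int (M mod p) < int p"
        using p by simp
      with M show "int p * K \<le> int M" "int M < int p * (K + 1)"
        by (simp_all add: ring_distribs)
    qed
    have pc: "\<bar>c\<bar> \<le> int p * \<bar>c\<bar>"
      using p by (simp add: mult_le_cancel_right1)
    have BK: "B (M div p) = {- K..K}"
      by (simp add: B_def K_def)
    have in_C: "m \<in> C" if "K - \<bar>c\<bar> \<le> \<bar>m\<bar>" "\<bar>m\<bar> \<le> K + \<bar>c\<bar>" for m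
    proof (cases "m \<ge> 0")
      case True
      then have "m = K + (m - K)" "m - K \<in> J"
        using that by (auto simp: J_def)
      then show ?thesis
        unfolding C_def by blast
    next
      case False
      then have "m = - (K + (- m - K))" "- m - K \<in> J"
        using that by (auto simp: J_def)
      then show ?thesis
        unfolding C_def by blast
    qed
    \<comment> \<open>As \<open>p * K \<le> M < p * (K + 1)\<close>, dividing the inequality that defines \<open>A M\<close> by \<open>p\<close>
        locates the boundary of \<open>A M\<close> up to an error of \<open>\<bar>c\<bar>\<close>.\<close>
    have pm: "\<bar>int p * m\<bar> = int p * \<bar>m\<bar>" for m
      by (simp add: abs_mult)
    have upper: "\<bar>m\<bar> \<le> K + \<bar>c\<bar>" if "m \<in> A M" for m
    proof -
      have "int p * \<bar>m\<bar> \<le> int M + \<bar>c\<bar>"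
        using that pm[of m] by (simp add: A_def)
      also have "\<dots> < int p * (K + 1 + \<bar>c\<bar>)"
        using K pc by (simp add: ring_distribs)
      finally show ?thesis
        using p by (simp add: mult_less_cancel_left_pos)
    qed
    have lower: "K - \<bar>c\<bar> \<le> \<bar>m\<bar>" if "m \<notin> A M" for m
    proof -
      have "int p * (K - \<bar>c\<bar>) \<le> int M - \<bar>c\<bar>"
        using K pc by (simp add: ring_distribs)
      also have "\<dots> < int p * \<bar>m\<bar>"
        using that pm[of m] by (simp add: A_def)
      finally show ?thesis
        using p by (simp add: mult_less_cancel_left_pos)
    qed
    have sub: "(A M - B (M div p)) \<union> (B (M div p) - A M) \<subseteq> C"
    proof (intro subsetI in_C)
      fix m assume m: "m \<in> (A M - B (M div p)) \<union> (B (M div p) - A M)"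
      show "K - \<bar>c\<bar> \<le> \<bar>m\<bar>"
        using m lower[of m] by (auto simp: BK)
      show "\<bar>m\<bar> \<le> K + \<bar>c\<bar>"
        using m upper[of m] by (auto simp: BK)
    qed
    have finA: "finite (A M)"
      by (rule finite_subset[of _ "{- (K + \<bar>c\<bar>)..K + \<bar>c\<bar>}"]) (use upper in force)+
    have finB: "finite (B (M div p))" and finJ: "finite J"
      by (simp_all add: B_def J_def)
    have finC: "finite C"
      using finJ by (simp add: C_def)
    have "(\<Sum>m\<in>A M. b m) - (\<Sum>m\<in>B (M div p). b m)
        = (\<Sum>m\<in>A M - B (M div p). b m) - (\<Sum>m\<in>B (M div p) - A M. b m)"
      using finA finB sum.Int_Diff[of "A M" b "B (M div p)"] sum.Int_Diff[of "B (M div p)" b "A M"]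
      by (simp add: Int_commute)
    then have "norm ((\<Sum>m\<in>A M. b m) - (\<Sum>m\<in>B (M div p). b m))
        \<le> norm (\<Sum>m\<in>A M - B (M div p). b m) + norm (\<Sum>m\<in>B (M div p) - A M. b m)"
      by (simp add: norm_triangle_ineq4)
    also have "\<dots> \<le> (\<Sum>m\<in>A M - B (M div p). norm (b m)) + (\<Sum>m\<in>B (M div p) - A M. norm (b m))"
      by (intro add_mono norm_sum)
    also have "\<dots> = (\<Sum>m\<in>(A M - B (M div p)) \<union> (B (M div p) - A M). norm (b m))"
      using finA finB by (intro sum.union_disjoint[symmetric]) auto
    also have "\<dots> \<le> (\<Sum>m\<in>C. norm (b m))"
      using sub finC by (intro sum_mono2) auto
    also have "\<dots> \<le> (\<Sum>m\<in>(\<lambda>j. K + j) ` J. norm (b m)) + (\<Sum>m\<in>(\<lambda>j. - (K + j)) ` J. norm (b m))"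
      unfolding C_def using finJ
      by (subst sum_Un) (auto intro!: sum_nonneg)
    also have "\<dots> = R M"
      by (simp add: R_def K_def sum.reindex inj_on_def sum.distrib)
    finally show ?thesis .
  qed
  have "(\<lambda>M. (\<Sum>m\<in>A M. b m) - (\<Sum>m\<in>B (M div p). b m)) \<longlonglongrightarrow> 0"
    by (rule Lim_null_comparison[OF _ R]) (simp add: bound)
  then have "(\<lambda>M. (\<Sum>m\<in>A M. b m)) \<longlonglongrightarrow> S"
    using tendsto_add[OF _ sym] by fastforce
  then show ?thesis
    by (simp add: A_def)
qed


section \<open>Modulating a 1-periodic function to a p-periodic one\<close>

text \<open>
  Cutting \<open>[0, p]\<close> into unit intervals turns the coefficient into an integral over \<open>[0, 1]\<close> times
  a sum over \<open>p\<close>-th roots of unity, which selects the indices congruent to \<open>c\<close> modulo \<open>p\<close>.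
\<close>

lemma fourier_coeff_modulate:
  fixes g :: "real \<Rightarrow> complex"
  assumes p: "p > 0" and cont: "continuous_on UNIV g" and per: "periodic_fun_simple g 1"
  shows "fourier_coeff (real p) (\<lambda>u. wave (of_int c * u / real p) * g u) l
           = (if int p dvd l - c then fourier_coeff 1 g ((l - c) div int p) else 0)"
proof -
  interpret periodic_fun_simple g 1 by fact
  define F where "F u = wave (of_int (c - l) * u / real p) * g u" for u
  have contF: "continuous_on UNIV F"
    unfolding F_def using p by (intro continuous_intros cont) auto
  have int: "F integrable_on {x..y}" for x y
    by (intro integrable_continuous_real continuous_on_subset[OF contF]) auto
  have unit: "integral {real r..real r + 1} F
      = wave (of_int (c - l) * real r / real p) * integral {0..1} F" for r
  proof -
    have "integral {real r..real r + 1} F = integral {0..1} (\<lambda>u. F (u + real r))"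
      using integral_shift_real_ivl[of "real r" "real r" "real r + 1" F] by simp
    also have "(\<lambda>u. F (u + real r)) = (\<lambda>u. wave (of_int (c - l) * real r / real p) * F u)"
    proof
      fix u
      have "wave (of_int (c - l) * (u + real r) / real p)
          = wave (of_int (c - l) * real r / real p) * wave (of_int (c - l) * u / real p)"
        by (simp only: distrib_left add_divide_distrib wave_add) (simp only: mult.commute)
      moreover have "g (u + real r) = g u"
        using plus_of_nat[of u r] by simp
      ultimately show "F (u + real r) = wave (of_int (c - l) * real r / real p) * F u"
        by (simp add: F_def)
    qed
    finally show ?thesis
      by simp
  qed
  have "integral {0..real n} F = (\<Sum>r<n. wave (of_int (c - l) * real r / real p)) * integral {0..1} F"
    for n
  proof (induction n)
    case (Suc n)
    have "integral {0..real (Suc n)} F = integral {0..real n} F + integral {real n..real n + 1} F"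
      using Henstock_Kurzweil_Integration.integral_combine[OF _ _ int, of 0 "real n" "real n + 1"] by (simp add: add.commute)
    then show ?case
      by (simp only: Suc.IH unit sum.lessThan_Suc ring_distribs)
  qed simp
  from this[of p] have "integral {0..real p} F
      = (if int p dvd c - l then of_nat p else 0) * integral {0..1} F"
    by (simp only: sum_wave_multiples[OF p])
  moreover have "fourier_coeff (real p) (\<lambda>u. wave (of_int c * u / real p) * g u) l
      = integral {0..real p} F / of_nat p"
  proof -
    have "wave (of_int c * u / real p) * g u * wave (- (of_int l * u / real p)) = F u" for u
    proof -
      have "wave (of_int c * u / real p) * wave (- (of_int l * u / real p))
          = wave (of_int (c - l) * u / real p)"
        by (simp add: ring_distribs diff_divide_distrib flip: wave_add)
      then show ?thesis
        by (simp add: F_def mult_ac)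
    qed
    then show ?thesis
      by (simp add: fourier_coeff_wave)
  qed
  ultimately have *: "fourier_coeff (real p) (\<lambda>u. wave (of_int c * u / real p) * g u) l
      = (if int p dvd l - c then integral {0..1} F else 0)"
    using p by (auto simp: dvd_diff_commute)
  have "integral {0..1} F = fourier_coeff 1 g ((l - c) div int p)" if dvd: "int p dvd l - c"
  proof -
    from dvd obtain m where m: "l - c = int p * m"
      by (elim dvdE)
    have "of_int (c - l) = - (real p * of_int m)"
      using arg_cong[OF m, of real_of_int] by simp
    then have "F = (\<lambda>u. g u * wave (- (of_int m * u)))"
      using p by (simp add: F_def[abs_def] mult.commute)
    then show ?thesis
      using m p by (simp add: fourier_coeff_wave)
  qed
  with * show ?thesis
    by simp
qed

text \<open>
  The substitution \<open>l = c + p m\<close> identifies the \<open>M\<close>-th symmetric partial sum of the product with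
  the partial sum over \<open>\<bar>c + p m\<bar> \<le> M\<close> of the original series; continuity of \<open>g\<close> makes the
  coefficients vanish at infinity, so these asymmetric sums have the symmetric limit.
\<close>

lemma has_fourier_series_modulate:
  fixes g :: "real \<Rightarrow> complex"
  assumes p: "p > 0" and cont: "continuous_on UNIV g" and per: "periodic_fun_simple g 1"
    and ser: "has_fourier_series 1 g a"
  shows "has_fourier_series (real p) (\<lambda>u. wave (of_int c * u / real p) * g u)
           (\<lambda>l. if int p dvd l - c then a ((l - c) div int p) else 0)"
  unfolding has_fourier_series_wave
proof (intro conjI allI)
  interpret periodic_fun_simple g 1 by fact
  have coeff: "fourier_coeff 1 g m = a m" for m
    using ser by (simp add: has_fourier_series_wave)
  show "fourier_coeff (real p) (\<lambda>u. wave (of_int c * u / real p) * g u) l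
      = (if int p dvd l - c then a ((l - c) div int p) else 0)" for l
    by (simp add: fourier_coeff_modulate[OF p cont per] coeff)
  fix u
  define b where "b m = a m * wave (of_int m * u)" for m
  have "(\<lambda>M. \<Sum>m | \<bar>c + int p * m\<bar> \<le> int M. b m) \<longlonglongrightarrow> g u"
  proof (rule tendsto_sum_shifted_window[OF _ _ p])
    show "(\<lambda>M. \<Sum>m\<in>{- int M..int M}. b m) \<longlonglongrightarrow> g u"
      using ser by (simp add: has_fourier_series_wave b_def)
    show "\<exists>K. \<forall>m. \<bar>m\<bar> \<ge> K \<longrightarrow> norm (b m) < e" if "e > 0" for e
      using riemann_lebesgue_continuous_periodic[OF cont plus_period \<open>e > 0\<close>]
      by (metis b_def coeff mult.right_neutral norm_mult norm_wave)
  qed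
  then have "(\<lambda>M. wave (of_int c * u / real p) * (\<Sum>m | \<bar>c + int p * m\<bar> \<le> int M. b m))
      \<longlonglongrightarrow> wave (of_int c * u / real p) * g u"
    by (rule tendsto_mult_left)
  moreover have "(\<Sum>l\<in>{- int M..int M}. (if int p dvd l - c then a ((l - c) div int p) else 0)
        * wave (of_int l * u / real p))
      = wave (of_int c * u / real p) * (\<Sum>m | \<bar>c + int p * m\<bar> \<le> int M. b m)" for M
  proof -
    have "(\<Sum>l\<in>{- int M..int M}. (if int p dvd l - c then a ((l - c) div int p) else 0)
        * wave (of_int l * u / real p))
      = (\<Sum>l\<in>{l\<in>{- int M..int M}. int p dvd l - c}. a ((l - c) div int p)
        * wave (of_int l * u / real p))"
      by (subst sum.inter_filter) (auto intro!: sum.cong)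
    also have "\<dots> = (\<Sum>m | \<bar>c + int p * m\<bar> \<le> int M. a m * wave (of_int (c + int p * m) * u / real p))"
      by (rule sum.reindex_bij_witness[of _ "\<lambda>m. c + int p * m" "\<lambda>l. (l - c) div int p"])
         (use p in auto)
    also have "\<dots> = (\<Sum>m | \<bar>c + int p * m\<bar> \<le> int M. wave (of_int c * u / real p) * b m)"
    proof (rule sum.cong[OF refl])
      fix m
      have "of_int (c + int p * m) * u / real p = of_int c * u / real p + of_int m * u"
        using p by (simp add: field_simps)
      then show "a m * wave (of_int (c + int p * m) * u / real p) = wave (of_int c * u / real p) * b m"
        by (simp add: b_def wave_add)
    qed
    finally show ?thesis
      by (simp add: sum_distrib_left)
  qed
  ultimately show "(\<lambda>M. \<Sum>l\<in>{- int M..int M}.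
        (if int p dvd l - c then a ((l - c) div int p) else 0) * wave (of_int l * u / real p))
      \<longlonglongrightarrow> wave (of_int c * u / real p) * g u"
    by simp
qed

lemma has_fourier_series_sum:
  assumes "finite Z" and cont: "\<And>z. z \<in> Z \<Longrightarrow> continuous_on UNIV (f z)"
    and ser: "\<And>z. z \<in> Z \<Longrightarrow> has_fourier_series T (f z) (a z)"
  shows "has_fourier_series T (\<lambda>u. \<Sum>z\<in>Z. f z u) (\<lambda>l. \<Sum>z\<in>Z. a z l)"
  unfolding has_fourier_series_wave
proof (intro conjI allI)
  show "fourier_coeff T (\<lambda>u. \<Sum>z\<in>Z. f z u) l = (\<Sum>z\<in>Z. a z l)" for l
  proof -
    have "continuous_on {0..T} (f z)" if "z \<in> Z" for z
      using cont[OF that] by (rule continuous_on_subset) auto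
    then have "(\<lambda>u. f z u * wave (- (of_int l * u / T))) integrable_on {0..T}" if "z \<in> Z" for z
      using that unfolding divide_inverse
      by (intro integrable_continuous_real continuous_intros) auto
    then have "fourier_coeff T (\<lambda>u. \<Sum>z\<in>Z. f z u) l = (\<Sum>z\<in>Z. fourier_coeff T (f z) l)"
      using \<open>finite Z\<close>
      by (simp add: fourier_coeff_wave sum_distrib_right integral_sum sum_divide_distrib)
    also have "\<dots> = (\<Sum>z\<in>Z. a z l)"
      using ser by (intro sum.cong) (auto simp: has_fourier_series_wave)
    finally show ?thesis .
  qed
  show "(\<lambda>M. \<Sum>l\<in>{- int M..int M}. (\<Sum>z\<in>Z. a z l) * wave (of_int l * u / T)) \<longlonglongrightarrow> (\<Sum>z\<in>Z. f z u)" for u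
  proof -
    have "(\<lambda>M. \<Sum>z\<in>Z. \<Sum>l\<in>{- int M..int M}. a z l * wave (of_int l * u / T)) \<longlonglongrightarrow> (\<Sum>z\<in>Z. f z u)"
      using ser by (intro tendsto_sum) (auto simp: has_fourier_series_wave)
    then show ?thesis
      by (subst (asm) sum.swap) (simp add: sum_distrib_right)
  qed
qed


section \<open>Logarithms of the rotated parameter\<close>

text \<open>
  The difference \<open>z\<close> of the two logarithms satisfies \<open>exp z = \<zeta>\<close>, so \<open>p z\<close> is a multiple of
  \<open>2 \<pi> i\<close>.  Defining \<open>c\<close> by this multiple makes a discussion of branches superfluous.
\<close>

lemma clog_root_of_unity_mult:
  assumes "lam \<noteq> 0" and p: "p > 0" and \<zeta>: "\<zeta> ^ p = 1"
  obtains c :: int where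
    "clog q (\<zeta> * lam) = clog q lam + 2 * of_int c * of_real pi * \<i> / (of_nat p * of_real (ln (real q)))"
    "\<zeta> = wave (of_int c / real p)"
proof -
  have "\<zeta> \<noteq> 0"
    using p \<zeta> by (auto simp: power_0_left)
  define z where "z = Ln (\<zeta> * lam) - Ln lam"
  have ez: "exp z = \<zeta>"
    using \<open>lam \<noteq> 0\<close> \<open>\<zeta> \<noteq> 0\<close> by (simp add: z_def exp_diff)
  then have "exp (of_nat p * z) = 1"
    using \<zeta> by (simp add: exp_of_nat_mult)
  then obtain n :: int where n: "Re (of_nat p * z) = 0" "Im (of_nat p * z) = of_int (2 * n) * pi"
    by (auto simp: exp_eq_1)
  have z: "z = 2 * of_int n * of_real pi * \<i> / of_nat p"
    using n p by (simp add: complex_eq_iff field_simps)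
  have "clog q (\<zeta> * lam) = clog q lam + z / of_real (ln (real q))"
    by (simp add: clog_def z_def diff_divide_distrib)
  moreover have "\<zeta> = wave (of_int n / real p)"
    unfolding ez[symmetric] z by (simp add: wave_def cis_conv_exp mult_ac)
  ultimately show thesis
    by (intro that[of n]) (simp_all add: z)
qed

lemma nat_powr_imaginary:
  assumes "N > 0"
  shows "of_nat N powr (2 * of_int c * of_real pi * \<i> / (of_nat p * of_real (ln (real q))))
           = wave (of_int c * log (real q) (real N) / real p)"
proof -
  have "Ln (of_nat N) = of_real (ln (real N))"
    using assms Ln_of_real[of "real N"] by simp
  then show ?thesis
    using assms by (simp add: powr_def wave_def cis_conv_exp log_def mult_ac)
qed


section \<open>Collapsing the sum over roots of unity\<close>

theorem proposition5p1:
  fixes q k p :: nat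
    and lam :: complex
    and D :: "complex \<Rightarrow> complex"
    and Phis :: "complex \<Rightarrow> real \<Rightarrow> complex"
    and phis :: "complex \<Rightarrow> int \<Rightarrow> complex"
  assumes "q \<ge> 2" and "lam \<noteq> 0" and "p > 0"
    and "\<And>\<zeta>. \<zeta> ^ p = 1 \<Longrightarrow> continuous_on UNIV (Phis (\<zeta> * lam))"
    and "\<And>\<zeta>. \<zeta> ^ p = 1 \<Longrightarrow> periodic_fun_simple (Phis (\<zeta> * lam)) 1"
    and "\<And>\<zeta>. \<zeta> ^ p = 1 \<Longrightarrow> has_fourier_series 1 (Phis (\<zeta> * lam)) (phis (\<zeta> * lam))"
    and "\<And>\<zeta> l. \<zeta> ^ p = 1 \<Longrightarrow>
           has_residue
             (\<lambda>s. D s * (s - clog q (\<zeta> * lam)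
                          - 2 * of_int l * of_real pi * \<i> / of_real (ln (real q))) ^ k)
             (clog q (\<zeta> * lam) + 2 * of_int l * of_real pi * \<i> / of_real (ln (real q)))
             (phis (\<zeta> * lam) l)"
  shows "\<exists>(Phi :: real \<Rightarrow> complex) (phi :: int \<Rightarrow> complex).
           continuous_on UNIV Phi \<and>
           periodic_fun_simple Phi (real p) \<and>
           has_fourier_series (real p) Phi phi \<and>
           (\<forall>l. has_residue
             (\<lambda>s. D s * (s - clog q lam
                          - 2 * of_int l * of_real pi * \<i> / (of_nat p * of_real (ln (real q)))) ^ k)
             (clog q lam + 2 * of_int l * of_real pi * \<i> / (of_nat p * of_real (ln (real q))))
             (phi l)) \<and>
           (\<forall>N::nat. N > 0 \<longrightarrow>
             (\<Sum>\<zeta> | \<zeta> ^ p = 1.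
                of_nat N powr clog q (\<zeta> * lam) * of_real (log (real q) (real N)) ^ k
                  * Phis (\<zeta> * lam) (frac (log (real q) (real N))))
             = of_nat N powr clog q lam * of_real (log (real q) (real N)) ^ k
                 * Phi (real p * frac (log (real (q ^ p)) (real N))))"
proof -
  note q = assms(1) and lam = assms(2) and p = assms(3)
  define U where "U = {\<zeta> :: complex. \<zeta> ^ p = 1}"
  have finU: "finite U"
    using p unfolding U_def by (intro finite_roots_unity) simp
  have "\<forall>\<zeta>\<in>U. \<exists>c::int.
      clog q (\<zeta> * lam) = clog q lam + 2 * of_int c * of_real pi * \<i> / (of_nat p * of_real (ln (real q)))
      \<and> \<zeta> = wave (of_int c / real p)"
    using clog_root_of_unity_mult[OF lam p] unfolding U_def by blast
  then obtain c :: "complex \<Rightarrow> int" where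
    clog: "\<And>\<zeta>. \<zeta> \<in> U \<Longrightarrow> clog q (\<zeta> * lam)
        = clog q lam + 2 * of_int (c \<zeta>) * of_real pi * \<i> / (of_nat p * of_real (ln (real q)))"
    and root: "\<And>\<zeta>. \<zeta> \<in> U \<Longrightarrow> \<zeta> = wave (of_int (c \<zeta>) / real p)"
    by metis
  have cont: "continuous_on UNIV (Phis (\<zeta> * lam))"
    and per: "periodic_fun_simple (Phis (\<zeta> * lam)) 1"
    and ser: "has_fourier_series 1 (Phis (\<zeta> * lam)) (phis (\<zeta> * lam))" if "\<zeta> \<in> U" for \<zeta>
    using that assms(4-6) by (auto simp: U_def)

  define Psi where "Psi \<zeta> u = wave (of_int (c \<zeta>) * u / real p) * Phis (\<zeta> * lam) u" for \<zeta> u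
  define psi where
    "psi \<zeta> l = (if int p dvd l - c \<zeta> then phis (\<zeta> * lam) ((l - c \<zeta>) div int p) else 0)" for \<zeta> l
  define Phi where "Phi u = (\<Sum>\<zeta>\<in>U. Psi \<zeta> u)" for u
  define phi where "phi l = (\<Sum>\<zeta>\<in>U. psi \<zeta> l)" for l

  have cont_Psi: "continuous_on UNIV (Psi \<zeta>)" if "\<zeta> \<in> U" for \<zeta>
    unfolding Psi_def using p by (intro continuous_intros cont[OF that]) auto
  have cont_Phi: "continuous_on UNIV Phi"
    unfolding Phi_def by (intro continuous_intros cont_Psi)

  have "Psi \<zeta> (u + real p) = Psi \<zeta> u" if "\<zeta> \<in> U" for \<zeta> u
  proof -
    interpret periodic_fun_simple "Phis (\<zeta> * lam)" 1
      by (rule per[OF that])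
    have "of_int (c \<zeta>) * (u + real p) / real p = of_int (c \<zeta>) * u / real p + of_int (c \<zeta>)"
      using p by (simp add: field_simps)
    then show ?thesis
      using plus_of_nat[of u p] by (simp add: Psi_def wave_add)
  qed
  then have per_Phi: "periodic_fun_simple Phi (real p)"
    by (intro periodic_fun_simple.intro) (simp add: Phi_def)

  have ser_Phi: "has_fourier_series (real p) Phi phi"
    unfolding Phi_def phi_def
  proof (rule has_fourier_series_sum[OF finU cont_Psi])
    show "has_fourier_series (real p) (Psi \<zeta>) (psi \<zeta>)" if "\<zeta> \<in> U" for \<zeta>
      unfolding Psi_def psi_def
      by (rule has_fourier_series_modulate[OF p cont[OF that] per[OF that] ser[OF that]])
  qed

  have res: "has_residue
             (\<lambda>s. D s * (s - clog q lam
                          - 2 * of_int l * of_real pi * \<i> / (of_nat p * of_real (ln (real q)))) ^ k)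
             (clog q lam + 2 * of_int l * of_real pi * \<i> / (of_nat p * of_real (ln (real q))))
             (phi l)" for l
  proof -
    \<comment> \<open>The only root of unity whose index class contains \<open>l\<close>.\<close>
    define \<zeta> where "\<zeta> = wave (of_int l / real p)"
    have \<zeta>: "\<zeta> \<in> U"
      using p by (simp add: U_def \<zeta>_def wave_power)
    have dvd_iff: "int p dvd l - c \<xi> \<longleftrightarrow> \<xi> = \<zeta>" if "\<xi> \<in> U" for \<xi>
    proof -
      have "\<zeta> = \<xi> \<longleftrightarrow> of_int l / real p - of_int (c \<xi>) / real p \<in> \<int>"
        unfolding \<zeta>_def by (subst root[OF that]) (rule wave_eq_iff)
      also have "\<dots> \<longleftrightarrow> int p dvd l - c \<xi>"
        using of_int_divide_in_Ints_iff[OF p, of "l - c \<xi>"] by (simp add: diff_divide_distrib)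
      finally show ?thesis by auto
    qed
    from dvd_iff[OF \<zeta>] obtain m where m: "l - c \<zeta> = int p * m"
      by (auto elim: dvdE)
    have "phi l = (\<Sum>\<xi>\<in>U. if \<xi> = \<zeta> then phis (\<zeta> * lam) m else 0)"
      unfolding phi_def psi_def using dvd_iff m p by (intro sum.cong) auto
    then have phi: "phi l = phis (\<zeta> * lam) m"
      using finU \<zeta> by simp
    have "(of_int l :: complex) = of_int (c \<zeta>) + of_nat p * of_int m"
      using arg_cong[OF m, of "of_int :: int \<Rightarrow> complex"] by (simp add: algebra_simps)
    moreover have "ln (real q) \<noteq> 0"
      using q by simp
    ultimately have shift: "clog q (\<zeta> * lam) + 2 * of_int m * of_real pi * \<i> / of_real (ln (real q))
        = clog q lam + 2 * of_int l * of_real pi * \<i> / (of_nat p * of_real (ln (real q)))"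
      using p by (simp add: clog[OF \<zeta>] field_simps)
    have "\<zeta> ^ p = 1"
      using \<zeta> by (simp add: U_def)
    from assms(7)[OF this, of m] show ?thesis
      by (simp only: phi diff_diff_eq shift)
  qed

  have ident: "(\<Sum>\<zeta> | \<zeta> ^ p = 1.
                of_nat N powr clog q (\<zeta> * lam) * of_real (log (real q) (real N)) ^ k
                  * Phis (\<zeta> * lam) (frac (log (real q) (real N))))
             = of_nat N powr clog q lam * of_real (log (real q) (real N)) ^ k
                 * Phi (real p * frac (log (real (q ^ p)) (real N)))" if N: "N > 0" for N :: nat
  proof -
    define L where "L = log (real q) (real N)"
    have "of_nat N powr clog q (\<zeta> * lam) * of_real L ^ k * Phis (\<zeta> * lam) (frac L)
        = of_nat N powr clog q lam * of_real L ^ k * Psi \<zeta> L" if \<zeta>: "\<zeta> \<in> U" for \<zeta>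
    proof -
      interpret periodic_fun_simple "Phis (\<zeta> * lam)" 1
        by (rule per[OF \<zeta>])
      have "Phis (\<zeta> * lam) (frac L) = Phis (\<zeta> * lam) L"
        using minus_of_int[of L "\<lfloor>L\<rfloor>"] by (simp add: frac_def)
      then show ?thesis
        using nat_powr_imaginary[OF N, of "c \<zeta>" p q]
        by (simp add: clog[OF \<zeta>] powr_add Psi_def L_def)
    qed
    then have "(\<Sum>\<zeta>\<in>U. of_nat N powr clog q (\<zeta> * lam) * of_real L ^ k * Phis (\<zeta> * lam) (frac L))
        = of_nat N powr clog q lam * of_real L ^ k * Phi L"
      unfolding Phi_def sum_distrib_left by (rule sum.cong[OF refl])
    moreover have "Phi (real p * frac (log (real (q ^ p)) (real N))) = Phi L"
    proof -
      interpret periodic_fun_simple Phi "real p"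
        by (rule per_Phi)
      have "log (real (q ^ p)) (real N) = L / real p"
        using q by (simp add: L_def log_base_pow)
      then have "real p * frac (log (real (q ^ p)) (real N)) = L - of_int \<lfloor>L / real p\<rfloor> * real p"
        using p by (simp only: frac_def) (simp add: right_diff_distrib)
      then show ?thesis
        by (simp add: minus_of_int)
    qed
    ultimately show ?thesis
      by (simp add: L_def U_def)
  qed
  show ?thesis
    using cont_Phi per_Phi ser_Phi res ident by blast
qed

end
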